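(* Let $n\ge 2$ and let $\mathfrak{sl}_n$ denote the Lie algebra of all trace-zero complex $n\times n$ matrices with bracket $[x,y]=xy-yx$. A linear map $\Delta:\mathfrak{sl}_n\to\mathfrak{sl}_n$ is a local automorphism if and only if there exist an invertible matrix $a\in M_n(\mathbb{C})$ and a sign $\varepsilon\in\{1,-1\}$ such that either $\Delta(x)=\varepsilon\, a x a^{-1}$ for all $x\in\mathfrak{sl}_n$, or $\Delta(x)=\varepsilon\, a x^t a^{-1}$ for all $x\in\mathfrak{sl}_n$. (Here $x^t$ is the transpose of $x$; equivalently, $\Delta$ is a local automorphism iff it is an automorphism or an anti-automorphism of $\mathfrak{sl}_n$.)
   Context: An automorphism of a Lie algebra $\mathcal{L}$ is an invertible linear map $\Phi$ with $\Phi([x,y])=[\Phi(x),\Phi(y)]$ for all $x,y$. A linear map $\Delta:\mathcal{L}\to\mathcal{L}$ is a local automorphism if for every $x\in\mathcal{L}$ there exists an automorphism $\Phi_x$ of $\mathcal{L}$ (depending on $x$) with $\Phi_x(x)=\Delta(x)$. *)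

theory Defs
  imports "HOL-Analysis.Analysis"
begin

definition sl :: "(complex^'n^'n) set" where
  "sl = {x. trace x = 0}"

definition lie_bracket :: "complex^'n^'n \<Rightarrow> complex^'n^'n \<Rightarrow> complex^'n^'n" where
  "lie_bracket x y = x ** y - y ** x"

definition cscale :: "complex \<Rightarrow> complex^'n^'n \<Rightarrow> complex^'n^'n" where
  "cscale c x = (\<chi> i j. c * x $ i $ j)"

text \<open>A (complex-)linear map from sl_n to sl_n (values outside sl_n are irrelevant).\<close>
definition sl_linear :: "(complex^'n^'n \<Rightarrow> complex^'n^'n) \<Rightarrow> bool" where
  "sl_linear D \<longleftrightarrow> (\<forall>x\<in>sl. D x \<in> sl)
     \<and> (\<forall>x\<in>sl. \<forall>y\<in>sl. D (x + y) = D x + D y)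
     \<and> (\<forall>c. \<forall>x\<in>sl. D (cscale c x) = cscale c (D x))"

definition sl_automorphism :: "(complex^'n^'n \<Rightarrow> complex^'n^'n) \<Rightarrow> bool" where
  "sl_automorphism F \<longleftrightarrow> sl_linear F \<and> bij_betw F sl sl
     \<and> (\<forall>x\<in>sl. \<forall>y\<in>sl. F (lie_bracket x y) = lie_bracket (F x) (F y))"

definition sl_local_automorphism :: "(complex^'n^'n \<Rightarrow> complex^'n^'n) \<Rightarrow> bool" where
  "sl_local_automorphism D \<longleftrightarrow> sl_linear D
     \<and> (\<forall>x\<in>sl. \<exists>F. sl_automorphism F \<and> F x = D x)"

end

theory Submission
  imports Defs "Jordan_Normal_Form.Jordan_Normal_Form_Existence"
begin

text \<open>
  If \<open>x\<close> is traceless of rank at most one, then \<open>[x, [x, y]] = - 2 tr(xy) x\<close>; conversely a traceless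
  \<open>z\<close> with \<open>[z, [z, y]] \<in> \<complex>z\<close> for all \<open>y\<close>, not always zero, has rank at most one. Hence automorphisms of
  \<open>sl\<^sub>n\<close> preserve the rank-one nilpotents and, as these span, the form \<open>tr(xy)\<close>. No
  classification of the automorphisms is needed: by polarisation a local automorphism \<open>D\<close> has both
  properties as well. Images of matrix units in a common row share either their column space or
  their row space, and up to a transposition it is always the former, so that
  \<open>D e\<^sub>i\<^sub>j = c\<^sub>i\<^sub>j a e\<^sub>i\<^sub>j a\<^sup>-\<^sup>1\<close> for \<open>i \<noteq> j\<close>. Suitable rank-one matrices then determine the
  scalars and the diagonal.

  Conversely, the maps of the theorem that are not automorphisms agree with one at each point,
  because a complex matrix is similar to its transpose.
\<close>

no_notation vec_index (infixl "$" 100)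
hide_const (open) Matrix.mat
hide_fact (open) Matrix.vec_eq_iff Matrix.mat_def Matrix.transpose_transpose

section \<open>Matrix units and traceless matrices\<close>

definition munit :: "'n \<Rightarrow> 'n \<Rightarrow> complex^'n^'n" where
  "munit i j = (\<chi> a b. if a = i \<and> b = j then 1 else 0)"

lemma munit_nth [simp]: "munit i j $ a $ b = (if a = i \<and> b = j then 1 else 0)"
  by (simp add: munit_def)

lemma cscale_nth [simp]: "cscale c x $ i $ j = c * x $ i $ j"
  by (simp add: cscale_def)

lemma mmult_nth: "(x ** y) $ i $ j = (\<Sum>k\<in>UNIV. x $ i $ k * y $ k $ j)"
  by (simp add: matrix_matrix_mult_def)

lemma mat_eqI: "(\<And>i j. x $ i $ j = y $ i $ j) \<Longrightarrow> x = y"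
  by (simp add: vec_eq_iff)

lemma sum_mult_delta: "(\<Sum>k\<in>(UNIV::'n::finite set). f k * (if P \<and> k = i then 1 else 0)) = (if P then f i else (0::complex))"
  by (cases P) (simp_all add: if_distrib cong: if_cong)

lemma sum_delta_mult: "(\<Sum>k\<in>(UNIV::'n::finite set). (if P \<and> k = i then 1 else 0) * f k) = (if P then f i else (0::complex))"
  by (cases P) (simp_all add: if_distrib[of "\<lambda>z. z * _"] cong: if_cong)

lemma mult_munit_nth: "(x ** munit j k) $ a $ b = (if b = k then x $ a $ j else 0)"
  using sum_mult_delta[of "\<lambda>l. x $ a $ l" "b = k" j] by (simp add: mmult_nth conj_commute)

lemma munit_mult_nth: "(munit j k ** x) $ a $ b = (if a = j then x $ k $ b else 0)"
  using sum_delta_mult[of "a = j" k "\<lambda>l. x $ l $ b"] by (simp add: mmult_nth)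

lemma mult_munit_mult_nth: "(x ** munit j k ** y) $ a $ b = x $ a $ j * y $ k $ b"
proof -
  have "(x ** munit j k ** y) $ a $ b = (\<Sum>l\<in>UNIV. (if l = k then x $ a $ j else 0) * y $ l $ b)"
    by (simp only: mmult_nth[of "x ** munit j k"] mult_munit_nth)
  also have "\<dots> = (\<Sum>l\<in>UNIV. if l = k then x $ a $ j * y $ l $ b else 0)"
    by (rule sum.cong) auto
  finally show ?thesis by simp
qed

lemma diff_mmult: "(x - y) ** z = x ** z - y ** (z::complex^'n^'n)"
  by (rule mat_eqI) (simp add: mmult_nth algebra_simps sum_subtractf)

lemma add_mmult: "(x + y) ** z = x ** z + y ** (z::complex^'n^'n)"
  by (rule mat_eqI) (simp add: mmult_nth algebra_simps sum.distrib)

lemma mmult_diff: "z ** (x - y) = z ** x - z ** (y::complex^'n^'n)"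
  by (rule mat_eqI) (simp add: mmult_nth algebra_simps sum_subtractf)

lemma cscale_mmult [simp]: "cscale c x ** y = cscale c (x ** y)"
  by (rule mat_eqI) (simp add: mmult_nth sum_distrib_left mult.assoc)

lemma mmult_cscale [simp]: "x ** cscale c y = cscale c (x ** y)"
  by (rule mat_eqI) (simp add: mmult_nth sum_distrib_left algebra_simps)

lemma mmult_zero [simp]: "x ** 0 = (0::complex^'n^'n)" "0 ** x = (0::complex^'n^'n)"
  by (rule mat_eqI; simp add: mmult_nth)+

lemma cscale_cscale [simp]: "cscale c (cscale d x) = cscale (c * d) x"
  by (rule mat_eqI) simp

lemma cscale_one [simp]: "cscale 1 x = x"
  by (rule mat_eqI) simp

lemma cscale_zero [simp]: "cscale 0 x = 0" "cscale c 0 = 0"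
  by (rule mat_eqI; simp)+

lemma cscale_add: "cscale c (x + y) = cscale c x + cscale c y"
  by (rule mat_eqI) (simp add: algebra_simps)

lemma cscale_diff: "cscale c (x - y) = cscale c x - cscale c y"
  by (rule mat_eqI) (simp add: algebra_simps)

lemma cscale_right_inject: "cscale c x = cscale d x \<longleftrightarrow> c = d \<or> x = 0"
  by (auto simp: vec_eq_iff)

lemma transpose_cscale: "transpose (cscale c x) = cscale c (transpose x)"
  by (rule mat_eqI) (simp add: transpose_def)

lemma transpose_nth [simp]: "transpose x $ i $ j = x $ j $ i"
  by (simp add: transpose_def)

lemma trace_cscale [simp]: "trace (cscale c x) = c * trace x"
  by (simp add: trace_def sum_distrib_left)

lemma trace_transpose [simp]: "trace (transpose x) = trace x"
  by (simp add: trace_def)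

lemma trace_munit: "trace (munit i j) = (if i = j then 1 else 0)"
  by (auto simp: trace_def intro!: sum.neutral)

lemma trace_mult_munit: "trace (x ** munit i j) = x $ j $ i"
  unfolding trace_def mult_munit_nth by simp

lemma trace_mult: "trace (x ** y) = (\<Sum>i\<in>UNIV. \<Sum>j\<in>UNIV. x $ i $ j * y $ j $ i)"
  by (simp add: trace_def mmult_nth)

lemma trace_conj:
  assumes "b ** a = mat 1" shows "trace (a ** x ** b) = trace (x::complex^'n^'n)"
proof -
  have "trace (a ** x ** b) = trace (b ** (a ** x))" by (rule trace_mul_sym)
  then show ?thesis by (simp add: matrix_mul_assoc assms)
qed

lemma sl_iff: "x \<in> sl \<longleftrightarrow> trace x = 0"
  by (simp add: sl_def)

lemma zero_sl [simp]: "0 \<in> sl"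
  by (simp add: sl_iff trace_def)

lemma add_sl: "x \<in> sl \<Longrightarrow> y \<in> sl \<Longrightarrow> x + y \<in> sl"
  by (simp add: sl_iff trace_add)

lemma diff_sl: "x \<in> sl \<Longrightarrow> y \<in> sl \<Longrightarrow> x - y \<in> sl"
  by (simp add: sl_iff trace_sub)

lemma cscale_sl: "x \<in> sl \<Longrightarrow> cscale c x \<in> sl"
  by (simp add: sl_iff)

lemma munit_sl: "i \<noteq> j \<Longrightarrow> munit i j \<in> sl"
  by (simp add: sl_iff trace_munit)

lemma munit_diff_sl: "munit i i - munit j j \<in> sl"
  by (simp add: sl_iff trace_munit trace_sub)

lemma bracket_sl: "lie_bracket x y \<in> sl"
  by (simp add: sl_iff lie_bracket_def trace_sub trace_mul_sym[of x y])

text \<open>The matrix units off the diagonal and the differences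
  \<open>munit i i - munit p p\<close> span the traceless matrices, for any choice of
  \<open>p\<close>.\<close>

lemma sl_induct [consumes 1, case_names add scale off diag zero]:
  assumes x: "x \<in> sl"
    and add: "\<And>x y. x \<in> sl \<Longrightarrow> y \<in> sl \<Longrightarrow> P x \<Longrightarrow> P y \<Longrightarrow> P (x + y)"
    and scale: "\<And>c x. x \<in> sl \<Longrightarrow> P x \<Longrightarrow> P (cscale c x)"
    and off: "\<And>i j. i \<noteq> j \<Longrightarrow> P (munit i j)"
    and diag: "\<And>i. i \<noteq> p \<Longrightarrow> P (munit i i - munit p p)"
    and zero: "P 0"
  shows "P (x::complex^'n^'n)"
proof -
  \<comment> \<open>Expanding \<open>x\<close> over \<open>?b\<close> instead of over the matrix
    units subtracts the trace of \<open>x\<close> from the \<open>(p, p)\<close> entry, hence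
    changes nothing. The term \<open>?b p p\<close> is zero.\<close>
  let ?b = "\<lambda>i j. munit i j - (if i = j then munit p p else 0)"
  have b: "?b i j \<in> sl \<and> P (?b i j)" for i j
    using off diag zero by (cases "i = j"; cases "i = p") (auto simp: munit_sl munit_diff_sl)
  have sum: "sum f A \<in> sl \<and> P (sum f A)" if "finite A" "\<And>i. f i \<in> sl \<and> P (f i)" for A and f :: "'n \<Rightarrow> _"
    using that by (induction A rule: finite_induct) (auto simp: add_sl add zero)
  have s: "cscale c (?b i j) \<in> sl \<and> P (cscale c (?b i j))" for c i j
    using b[of i j] cscale_sl scale by blast
  have "P (\<Sum>i\<in>UNIV. \<Sum>j\<in>UNIV. cscale (x $ i $ j) (?b i j))"
    by (rule conjunct2[OF sum[OF finite sum[OF finite s]]])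
  moreover have "(\<Sum>i\<in>UNIV. \<Sum>j\<in>UNIV. cscale (x $ i $ j) (?b i j)) = x"
  proof (rule mat_eqI)
    fix a c
    have "(\<Sum>i\<in>UNIV. \<Sum>j\<in>UNIV. cscale (x $ i $ j) (?b i j)) $ a $ c
       = (\<Sum>i\<in>UNIV. \<Sum>j\<in>UNIV. (if a = i \<and> c = j then x $ i $ j else 0) - (if i = j then (if a = p \<and> c = p then x $ i $ j else 0) else 0))"
      unfolding sum_component by (intro sum.cong refl) auto
    also have "\<dots> = (\<Sum>i\<in>UNIV. if a = i then x $ i $ c else 0) - (\<Sum>i\<in>UNIV. if a = p \<and> c = p then x $ i $ i else 0)"
      unfolding sum_subtractf
      by (intro arg_cong2[where f = minus] sum.cong refl) auto
    also have "\<dots> = x $ a $ c" using x by (cases "a = p \<and> c = p") (auto simp: sl_iff trace_def)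
    finally show "(\<Sum>i\<in>UNIV. \<Sum>j\<in>UNIV. cscale (x $ i $ j) (?b i j)) $ a $ c = x $ a $ c" .
  qed
  ultimately show ?thesis by simp
qed

section \<open>Rank-one matrices and the trace form\<close>

text \<open>All 2 x 2 minors vanish. This polynomial form of "rank at most one" can be tested entry
  by entry on explicit matrices.\<close>

definition rank_le_one :: "complex^'n^'n \<Rightarrow> bool" where
  "rank_le_one x \<longleftrightarrow> (\<forall>a b c d. x $ a $ b * x $ c $ d = x $ a $ d * x $ c $ b)"

lemma rank_le_oneD: "rank_le_one x \<Longrightarrow> x $ a $ b * x $ c $ d = x $ a $ d * x $ c $ b"
  unfolding rank_le_one_def by blast

text \<open>For \<open>x\<close> a column \<open>u\<close> times a row \<open>f\<close>, the middle
  factor \<open>f y u\<close> of \<open>x y x\<close> is a scalar, and it equals the trace of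
  \<open>x y\<close>. In entries, one minor relation swaps the two column indices.\<close>

lemma rank_le_one_mult_mult:
  assumes "rank_le_one x" shows "x ** y ** x = cscale (trace (x ** y)) x"
proof (rule mat_eqI)
  fix a b
  have "(x ** y ** x) $ a $ b = (\<Sum>l\<in>UNIV. \<Sum>k\<in>UNIV. x $ a $ k * y $ k $ l * x $ l $ b)"
    by (simp add: mmult_nth sum_distrib_right)
  also have "\<dots> = (\<Sum>l\<in>UNIV. \<Sum>k\<in>UNIV. x $ l $ k * y $ k $ l * x $ a $ b)"
  proof (intro sum.cong refl)
    fix l k
    show "x $ a $ k * y $ k $ l * x $ l $ b = x $ l $ k * y $ k $ l * x $ a $ b"
      using arg_cong[OF rank_le_oneD[OF assms, of a k l b], of "\<lambda>t. t * y $ k $ l"]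
      by (simp only: ac_simps)
  qed
  finally show "(x ** y ** x) $ a $ b = cscale (trace (x ** y)) x $ a $ b"
    by (simp add: trace_mult sum_distrib_right)
qed

text \<open>Since \<open>x ** x\<close> is \<open>trace x\<close> times \<open>x\<close>, it
  vanishes, and only the mixed terms \<open>- 2 x y x\<close> of the double bracket survive.\<close>

lemma rank_le_one_bracket_bracket:
  assumes "rank_le_one x" "x \<in> sl"
  shows "lie_bracket x (lie_bracket x y) = cscale (- 2 * trace (x ** y)) x"
proof -
  have "x ** x = 0"
    using rank_le_one_mult_mult[OF assms(1), of "mat 1"] assms(2) by (simp add: sl_iff)
  then have "x ** (x ** y) = 0" "y ** x ** x = 0"
    by (simp_all add: matrix_mul_assoc flip: matrix_mul_assoc[of y])
  then have "lie_bracket x (lie_bracket x y) = - (x ** y ** x) - (x ** y ** x)"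
    by (simp add: lie_bracket_def mmult_diff diff_mmult) (simp add: matrix_mul_assoc)
  then show ?thesis
    unfolding rank_le_one_mult_mult[OF assms(1)] by (intro mat_eqI) simp
qed

text \<open>Testing against off-diagonal units kills the off-diagonal entries, testing against
  \<open>munit i i - munit p p\<close> makes the diagonal constant, and the trace then kills that
  constant.\<close>

lemma trace_form_nondegenerate:
  assumes "x \<in> sl" "\<And>y. y \<in> sl \<Longrightarrow> trace (x ** y) = 0"
  shows "x = (0::complex^'n^'n)"
proof -
  obtain p :: 'n where True by simp
  have off: "x $ j $ i = 0" if "i \<noteq> j" for i j
    using assms(2)[OF munit_sl[OF that]] by (simp add: trace_mult_munit)
  have diag: "x $ i $ i = x $ p $ p" for i
    using assms(2)[OF munit_diff_sl[of i p]] by (simp add: mmult_diff trace_sub trace_mult_munit)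
  have "trace x = of_nat CARD('n) * x $ p $ p"
    unfolding trace_def by (subst sum.cong[OF refl diag]) simp
  then have "x $ p $ p = 0" using assms(1) by (simp add: sl_iff)
  then have "x $ i $ j = 0" for i j using off[of j i] diag[of i] by (cases "i = j") auto
  then show ?thesis by (intro mat_eqI) simp
qed

section \<open>Similarity of a matrix and its transpose\<close>

lemma index_mult_mat_sum:
  assumes "A \<in> carrier_mat n n" "B \<in> carrier_mat n n" "i < n" "j < n"
  shows "(A * B) $$ (i, j) = (\<Sum>k = 0..<n. A $$ (i, k) * B $$ (k, j))"
  using assms by (auto simp: scalar_prod_def intro!: sum.cong)

text \<open>Reversing the order of the basis turns a Jordan block into its transpose.\<close>

lemma jordan_block_similar_transpose:
  "similar_mat (jordan_block n (a::complex)) (transpose_mat (jordan_block n a))"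
proof -
  \<comment> \<open>The exchange matrix, which is its own inverse: multiplying by it on the left or
    right reverses the rows or columns.\<close>
  define K where "K = Matrix.mat n n (\<lambda>(i,j). if j = n - 1 - i then 1 else (0::complex))"
  define J where "J = jordan_block n a"
  have c: "K \<in> carrier_mat n n" "J \<in> carrier_mat n n" "transpose_mat J \<in> carrier_mat n n"
    by (auto simp: K_def J_def)
  have K: "K $$ (i, j) = (if j = n - 1 - i then 1 else 0)" if "i < n" "j < n" for i j
    using that by (simp add: K_def)
  have K_left: "(K * A) $$ (i, j) = A $$ (n - 1 - i, j)"
    if "A \<in> carrier_mat n n" "i < n" "j < n" for A i j
  proof -
    have "(K * A) $$ (i, j) = (\<Sum>k = 0..<n. if k = n - 1 - i then A $$ (k, j) else 0)"
      unfolding index_mult_mat_sum[OF c(1) that] using that by (intro sum.cong refl) (simp add: K)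
    then show ?thesis using that by simp
  qed
  have K_right: "(A * K) $$ (i, j) = A $$ (i, n - 1 - j)"
    if "A \<in> carrier_mat n n" "i < n" "j < n" for A i j
  proof -
    have "(A * K) $$ (i, j) = (\<Sum>k = 0..<n. if k = n - 1 - j then A $$ (i, k) else 0)"
      unfolding index_mult_mat_sum[OF that(1) c(1) that(2,3)] using that by (intro sum.cong refl) (simp add: K)
    then show ?thesis using that by simp
  qed
  have KK: "K * K = 1\<^sub>m n"
    using c by (intro eq_matI) (auto simp: K_left K simp del: index_mult_mat(1))
  have "J = K * transpose_mat J * K"
  proof (rule eq_matI)
    fix i j assume "i < dim_row (K * transpose_mat J * K)" "j < dim_col (K * transpose_mat J * K)"
    then have ij: "i < n" "j < n" using c by auto
    have "(K * transpose_mat J * K) $$ (i, j) = transpose_mat J $$ (n - 1 - i, n - 1 - j)"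
      using ij K_right[OF mult_carrier_mat[OF c(1,3)] ij] K_left[OF c(3), of i "n - 1 - j"] by simp
    also have "\<dots> = J $$ (i, j)"
      using ij by (auto simp: J_def)
    finally show "J $$ (i, j) = (K * transpose_mat J * K) $$ (i, j)" ..
  qed (use c in auto)
  then show ?thesis
    using c KK unfolding J_def[symmetric] by (intro similar_matI[of _ _ K K n]) auto
qed

lemma jordan_matrix_similar_transpose:
  "similar_mat (jordan_matrix (as :: (nat \<times> complex) list)) (transpose_mat (jordan_matrix as))"
proof (induction as)
  case Nil
  then show ?case
    by (intro similar_matI[of _ _ "1\<^sub>m 0" "1\<^sub>m 0" 0]) (auto simp: jordan_matrix_def)
next
  case (Cons b as)
  obtain n a where b: "b = (n, a)" by force
  let ?m = "sum_list (map fst as)"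
  have "transpose_mat (jordan_matrix (b # as)) = four_block_mat (transpose_mat (jordan_block n a))
      (0\<^sub>m n ?m) (0\<^sub>m ?m n) (transpose_mat (jordan_matrix as))"
    unfolding b jordan_matrix_Cons by (subst transpose_four_block_mat) auto
  then show ?case
    using similar_mat_four_block_0_0[OF jordan_block_similar_transpose Cons.IH jordan_block_carrier jordan_matrix_carrier]
    by (simp add: b jordan_matrix_Cons)
qed

lemma similar_mat_transpose_mat:
  fixes A B :: "'a::comm_ring_1 mat"
  assumes "similar_mat A B" shows "similar_mat (transpose_mat A) (transpose_mat B)"
proof -
  obtain n P Q where *: "{A,B,P,Q} \<subseteq> carrier_mat n n" "P * Q = 1\<^sub>m n" "Q * P = 1\<^sub>m n" "A = P * B * Q"
    using similar_matD[OF assms] by blast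
  have c: "A \<in> carrier_mat n n" "B \<in> carrier_mat n n" "P \<in> carrier_mat n n" "Q \<in> carrier_mat n n"
    using * by auto
  have "transpose_mat A = transpose_mat Q * (transpose_mat B * transpose_mat P)"
    unfolding *(4) using c transpose_mult[of "P * B" n n Q n] transpose_mult[of P n n B n] by simp
  also have "\<dots> = transpose_mat Q * transpose_mat B * transpose_mat P"
    using c by (intro assoc_mult_mat[symmetric, of _ n n _ n _ n]) auto
  finally show ?thesis
    using c *(2,3) by (intro similar_matI[of _ _ "transpose_mat Q" "transpose_mat P" n])
      (auto simp flip: transpose_mult[of _ n n _ n])
qed

text \<open>\<open>A\<close> is similar to its Jordan form, this to its own transpose blockwise, and
  the latter to the transpose of \<open>A\<close>. Complex entries ensure that the characteristic
  polynomial splits.\<close>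

lemma similar_mat_transpose:
  assumes A: "A \<in> carrier_mat n n"
  shows "similar_mat (A :: complex mat) (transpose_mat A)"
proof -
  obtain as where "jordan_nf A as"
    using char_poly_factorized[OF A] jordan_nf_exists[OF A] by blast
  then have "similar_mat A (jordan_matrix as)" by (simp add: jordan_nf_def)
  then show ?thesis
    using similar_mat_trans[OF similar_mat_trans[OF _ jordan_matrix_similar_transpose]]
      similar_mat_sym[OF similar_mat_transpose_mat] by blast
qed

lemma matrix_similar_transpose:
  "\<exists>p q. p ** q = mat 1 \<and> q ** p = mat 1 \<and> x = p ** transpose x ** (q :: complex^'n^'n)"
proof -
  let ?n = "CARD('n)"
  obtain h :: "nat \<Rightarrow> 'n" where h: "bij_betw h {0..<?n} UNIV"
    using ex_bij_betw_nat_finite[of "UNIV :: 'n set"] by auto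
  define g where "g = inv_into {0..<?n} h"
  have g: "g i < ?n" "h (g i) = i" for i
    using h by (auto simp: g_def bij_betw_def f_inv_into_f) (metis inv_into_into atLeastLessThan_iff UNIV_I)
  have bij_g: "bij_betw g UNIV {0..<?n}"
    unfolding g_def by (rule bij_betw_inv_into[OF h])
  define M where "M = Matrix.mat ?n ?n (\<lambda>(i,j). x $ h i $ h j)"
  \<comment> \<open>Re-indexing along an enumeration of the index type. Being multiplicative and
    unital, it carries the similarity of \<open>M\<close> and its transpose over to
    \<open>x\<close>.\<close>
  define \<phi> :: "complex mat \<Rightarrow> complex^'n^'n" where "\<phi> A = (\<chi> i j. A $$ (g i, g j))" for A
  have mult: "\<phi> (A * B) = \<phi> A ** \<phi> B" if "A \<in> carrier_mat ?n ?n" "B \<in> carrier_mat ?n ?n" for A B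
  proof (rule mat_eqI)
    fix i j
    have "\<phi> (A * B) $ i $ j = (\<Sum>k = 0..<?n. A $$ (g i, k) * B $$ (k, g j))"
      using that g by (simp add: \<phi>_def scalar_prod_def)
    also have "\<dots> = (\<Sum>k\<in>UNIV. A $$ (g i, g k) * B $$ (g k, g j))"
      by (rule sum.reindex_bij_betw[OF bij_g, symmetric])
    finally show "\<phi> (A * B) $ i $ j = (\<phi> A ** \<phi> B) $ i $ j"
      by (simp add: mmult_nth) (simp add: \<phi>_def)
  qed
  have M: "M \<in> carrier_mat ?n ?n" by (simp add: M_def)
  obtain n P Q where "{M, transpose_mat M, P, Q} \<subseteq> carrier_mat n n" "P * Q = 1\<^sub>m n" "Q * P = 1\<^sub>m n"
    and PQ: "M = P * transpose_mat M * Q"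
    using similar_matD[OF similar_mat_transpose[OF M]] by blast
  then have PQ1: "P * Q = 1\<^sub>m ?n" "Q * P = 1\<^sub>m ?n" and c: "P \<in> carrier_mat ?n ?n" "Q \<in> carrier_mat ?n ?n"
    using M by auto
  have one: "\<phi> (1\<^sub>m ?n) = mat 1"
  proof (rule mat_eqI)
    fix i j
    have "g i = g j \<longleftrightarrow> i = j" using g(2) by metis
    then show "\<phi> (1\<^sub>m ?n) $ i $ j = mat 1 $ i $ j" using g(1) by (simp add: \<phi>_def mat_def)
  qed
  have x: "\<phi> M = x" "\<phi> (transpose_mat M) = transpose x"
    using g by (auto intro!: mat_eqI simp: \<phi>_def M_def)
  have "\<phi> M = \<phi> P ** \<phi> (transpose_mat M) ** \<phi> Q"
    using c M by (subst PQ) (simp add: mult matrix_mul_assoc)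
  then have "\<phi> P ** \<phi> Q = mat 1" "\<phi> Q ** \<phi> P = mat 1" "x = \<phi> P ** transpose x ** \<phi> Q"
    using c by (simp_all add: PQ1 one x flip: mult)
  then show ?thesis by blast
qed

section \<open>Automorphisms and rank-one matrices\<close>

text \<open>With \<open>w\<close> the square and \<open>t\<close> the cube of \<open>z\<close>, the
  hypothesis reads \<open>w y - 2 z y z + y w = l(y) z\<close>. It forces \<open>t\<close> to be
  scalar, then \<open>w\<close> to be a multiple of \<open>z\<close>, then \<open>w = 0\<close>.
  What remains, \<open>- 2 z y z = l(y) z\<close>, says that the columns of \<open>z\<close> are
  proportional.\<close>

lemma rank_le_one_if_extremal:
  fixes z :: "complex^'n^'n"
  assumes z: "z \<in> sl"
    and ext: "\<And>y. y \<in> sl \<Longrightarrow> lie_bracket z (lie_bracket z y) = cscale (l y) z"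
    and nz: "y0 \<in> sl" "l y0 \<noteq> 0"
  shows "rank_le_one z"
proof (cases "z = 0")
  case True
  then show ?thesis by (simp add: rank_le_one_def)
next
  case False
  then obtain p q where pq: "z $ p $ q \<noteq> 0" by (metis mat_eqI zero_index)
  define w where "w = z ** z"
  define t where "t = w ** z"
  have dbl: "lie_bracket z (lie_bracket z y) = w ** y - (z ** y ** z + z ** y ** z) + y ** w" for y
    by (simp add: lie_bracket_def mmult_diff diff_mmult w_def matrix_mul_assoc algebra_simps)
  have ext_all: "\<exists>c. w ** y - (z ** y ** z + z ** y ** z) + y ** w = cscale c z" for y
  proof -
    \<comment> \<open>A scalar matrix is central, so subtracting the scalar part of \<open>y\<close>
      makes it traceless without changing the bracket with \<open>z\<close>.\<close>
    define s where "s = trace y / of_nat CARD('n)"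
    have "y - cscale s (mat 1) \<in> sl" by (simp add: sl_iff trace_sub trace_I s_def)
    then have "lie_bracket z (lie_bracket z (y - cscale s (mat 1))) = cscale (l (y - cscale s (mat 1))) z"
      by (rule ext)
    moreover have "lie_bracket z (y - cscale s (mat 1)) = lie_bracket z y"
      by (simp add: lie_bracket_def mmult_diff diff_mmult)
    ultimately show ?thesis unfolding dbl[symmetric] by auto
  qed
  \<comment> \<open>The trace of \<open>z [z, u]\<close> is always zero; for
    \<open>u = [z, y0]\<close> it equals \<open>l y0\<close> times the trace of
    \<open>w\<close>.\<close>
  have trw: "trace w = 0"
  proof -
    have "trace (z ** lie_bracket z u) = 0" for u
      using trace_mul_sym[of z "u ** z"] by (simp add: lie_bracket_def mmult_diff trace_sub matrix_mul_assoc trace_mul_sym[of "z ** z" u])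
    from this[of "lie_bracket z y0"] show ?thesis
      using nz(2) by (simp add: ext[OF nz(1)] w_def)
  qed
  \<comment> \<open>The double bracket is a multiple of \<open>z\<close> and so commutes with
    \<open>z\<close>; expanding this gives \<open>t y - y t = 3 (w y z - z y w)\<close>.\<close>
  have cube: "(t ** y - y ** t) - (w ** y ** z - z ** y ** w) - (w ** y ** z - z ** y ** w) - (w ** y ** z - z ** y ** w) = 0" for y
  proof -
    obtain c where c: "w ** y - (z ** y ** z + z ** y ** z) + y ** w = cscale c z"
      using ext_all by blast
    have "z ** (w ** y - (z ** y ** z + z ** y ** z) + y ** w) = (w ** y - (z ** y ** z + z ** y ** z) + y ** w) ** z"
      unfolding c by simp
    moreover have "z ** w = t" "w ** z = t" by (simp_all add: t_def w_def matrix_mul_assoc)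
    ultimately show ?thesis
      by (simp only: matrix_add_ldistrib add_mmult mmult_diff diff_mmult matrix_mul_assoc w_def t_def)
         (simp add: algebra_simps)
  qed
  have cube_nth: "(if k = b then t $ a $ j else 0) - (if a = j then t $ k $ b else 0)
      = 3 * (w $ a $ j * z $ k $ b - z $ a $ j * w $ k $ b)" for a b j k
    using arg_cong[OF cube[of "munit j k"], of "\<lambda>x. x $ a $ b"]
    by (auto simp: mult_munit_nth munit_mult_nth mult_munit_mult_nth algebra_simps)
  \<comment> \<open>Setting \<open>k = b\<close> and summing turns the right-hand side into a
    combination of the traces of \<open>z\<close> and \<open>w\<close>, both zero. So
    \<open>t\<close> is scalar.\<close>
  have "of_nat CARD('n) * t $ a $ j = (if a = j then trace t else 0)" for a j
  proof -
    have "(\<Sum>k\<in>UNIV. t $ a $ j - (if a = j then t $ k $ k else 0)) = (\<Sum>k\<in>UNIV. 3 * (w $ a $ j * z $ k $ k - z $ a $ j * w $ k $ k))"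
      using cube_nth[of b b a j for b] by (intro sum.cong refl) simp
    also have "\<dots> = 3 * (w $ a $ j * trace z - z $ a $ j * trace w)"
      by (simp add: trace_def sum_subtractf flip: sum_distrib_left)
    also have "\<dots> = 0" using z trw by (simp add: sl_iff)
    finally show ?thesis by (simp add: sum_subtractf trace_def split: if_splits)
  qed
  then have t: "t $ a $ j = (if a = j then trace t / of_nat CARD('n) else 0)" for a j
    by (simp add: field_simps) (metis mult_eq_0_iff of_nat_eq_0_iff zero_less_card_finite less_numeral_extra(3))
  \<comment> \<open>For scalar \<open>t\<close> the left-hand side of \<open>cube_nth\<close>
    vanishes, so \<open>w\<close> and \<open>z\<close> are proportional, with ratio read off at a
    nonzero entry of \<open>z\<close>.\<close>
  define \<mu> where "\<mu> = w $ p $ q / z $ p $ q"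
  have w: "w = cscale \<mu> z"
  proof (rule mat_eqI)
    fix a j
    have "w $ a $ j * z $ p $ q - z $ a $ j * w $ p $ q = 0"
      using cube_nth[of p q a j] by (simp add: t split: if_splits)
    then show "w $ a $ j = cscale \<mu> z $ a $ j" using pq by (simp add: \<mu>_def field_simps)
  qed
  have "t = cscale (\<mu> * \<mu>) z" by (simp add: t_def w flip: w_def) 
  moreover have "trace t = 0" using calculation z by (simp add: sl_iff)
  ultimately have "\<mu> * \<mu> * z $ p $ q = 0" using t[of p q] by (metis cscale_nth div_0)
  then have "\<mu> = 0" using pq by simp
  then have w0: "w = 0" using w by simp
  \<comment> \<open>With \<open>w = 0\<close>, taking \<open>y = munit j p\<close> and comparing
    column \<open>q\<close> gives \<open>- 2 z $ a $ j * z $ p $ q = c * z $ a $ q\<close>.\<close>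
  have "\<exists>c. \<forall>a. z $ a $ j = c * z $ a $ q" for j
  proof -
    obtain c where c: "w ** munit j p - (z ** munit j p ** z + z ** munit j p ** z) + munit j p ** w = cscale c z"
      using ext_all by blast
    have "z $ a $ j = - c / (2 * z $ p $ q) * z $ a $ q" for a
      using arg_cong[OF c, of "\<lambda>x. x $ a $ q"] pq
      by (simp add: w0 mult_munit_mult_nth field_simps) (metis minus_minus)
    then show ?thesis by blast
  qed
  then obtain c where c: "\<And>j a. z $ a $ j = c j * z $ a $ q" by metis
  show ?thesis
    unfolding rank_le_one_def by (subst (1 2 3 4) c) (simp add: ac_simps)
qed

section \<open>Invariants of automorphisms and of local automorphisms\<close>

lemma sl_linearD:
  assumes "sl_linear D"
  shows "x \<in> sl \<Longrightarrow> D x \<in> sl" "x \<in> sl \<Longrightarrow> y \<in> sl \<Longrightarrow> D (x + y) = D x + D y"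
    "x \<in> sl \<Longrightarrow> D (cscale c x) = cscale c (D x)"
  using assms by (auto simp: sl_linear_def)

lemma sl_linear_zero: "sl_linear D \<Longrightarrow> D 0 = 0"
  using sl_linearD(3)[of D 0 0] by simp

lemma sl_linear_diff:
  assumes "sl_linear D" "x \<in> sl" "y \<in> sl"
  shows "D (x - y) = D x - D y"
proof -
  have "x - y = x + cscale (-1) y" by (rule mat_eqI) simp
  then have "D (x - y) = D x + cscale (-1) (D y)"
    using assms by (simp only: sl_linearD cscale_sl)
  also have "\<dots> = D x - D y" by (rule mat_eqI) simp
  finally show ?thesis .
qed

lemma sl_automorphism_eq_zero_iff:
  assumes "sl_automorphism F" "x \<in> sl"
  shows "F x = 0 \<longleftrightarrow> x = 0"
proof -
  have lin: "sl_linear F" and inj: "inj_on F sl"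
    using assms by (auto simp: sl_automorphism_def bij_betw_def)
  show ?thesis
    using inj_onD[OF inj _ assms(2) zero_sl] sl_linear_zero[OF lin] by auto
qed

text \<open>\<open>F\<close> carries the double bracket identity of \<open>x\<close> over to
  \<open>F x\<close>. By surjectivity \<open>F x\<close> is then extremal, with a coefficient that
  is not identically zero unless \<open>x = 0\<close>. Once \<open>F x\<close> has rank one,
  comparing the two coefficients gives the trace identity.\<close>

lemma sl_automorphism_rank_le_one:
  fixes x y :: "complex^'n^'n"
  assumes F: "sl_automorphism F" and x: "x \<in> sl" "rank_le_one x"
  shows "rank_le_one (F x)" "y \<in> sl \<Longrightarrow> trace (F x ** F y) = trace (x ** y)"
proof -
  have lin: "sl_linear F" and surj: "F ` sl = sl"
    and br: "\<And>x y. x \<in> sl \<Longrightarrow> y \<in> sl \<Longrightarrow> F (lie_bracket x y) = lie_bracket (F x) (F y)"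
    using F by (auto simp: sl_automorphism_def bij_betw_def)
  have dbl: "lie_bracket (F x) (lie_bracket (F x) (F y)) = cscale (- 2 * trace (x ** y)) (F x)"
    if "y \<in> sl" for y
    using x that by (simp add: rank_le_one_bracket_bracket sl_linearD[OF lin] bracket_sl flip: br)
  have Fx: "F x \<in> sl" using lin x by (simp add: sl_linearD)
  show r: "rank_le_one (F x)"
  proof (cases "x = 0")
    case True
    then show ?thesis by (simp add: sl_linear_zero[OF lin] rank_le_one_def)
  next
    case False
    then obtain y where y: "y \<in> sl" "trace (x ** y) \<noteq> 0"
      using trace_form_nondegenerate x(1) by blast
    define g where "g = inv_into sl F"
    have g: "g z \<in> sl" "F (g z) = z" if "z \<in> sl" for z
      using that surj by (auto simp: g_def inv_into_into f_inv_into_f)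
    have gF: "g (F y) = y"
      using F y(1) by (simp add: g_def sl_automorphism_def bij_betw_def)
    show ?thesis
    proof (rule rank_le_one_if_extremal[OF Fx, where l = "\<lambda>z. - 2 * trace (x ** g z)" and ?y0.0 = "F y"])
      fix z :: "complex^'n^'n" assume "z \<in> sl"
      then show "lie_bracket (F x) (lie_bracket (F x) z) = cscale (- 2 * trace (x ** g z)) (F x)"
        using dbl[of "g z"] g[of z] by simp
    qed (use y gF lin in \<open>auto simp: sl_linearD\<close>)
  qed
  show "trace (F x ** F y) = trace (x ** y)" if y: "y \<in> sl"
  proof (cases "x = 0")
    case True
    then show ?thesis by (simp add: sl_linear_zero[OF lin])
  next
    case False
    then have "F x \<noteq> 0" using sl_automorphism_eq_zero_iff[OF F x(1)] by simp
    moreover have "cscale (- 2 * trace (F x ** F y)) (F x) = cscale (- 2 * trace (x ** y)) (F x)"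
      using dbl[OF y] rank_le_one_bracket_bracket[OF r Fx, of "F y"] by simp
    ultimately show ?thesis by (simp add: cscale_right_inject)
  qed
qed

lemma rank_le_one_munit: "rank_le_one (munit i j)"
  by (auto simp: rank_le_one_def)

text \<open>The identity is linear in \<open>x\<close> and known for rank-one nilpotents, which
  span.\<close>

lemma sl_automorphism_trace_mult:
  fixes x y :: "complex^'n^'n"
  assumes F: "sl_automorphism F" and x: "x \<in> sl" and y: "y \<in> sl"
  shows "trace (F x ** F y) = trace (x ** y)"
proof -
  have lin: "sl_linear F" using F by (auto simp: sl_automorphism_def)
  note [simp] = sl_linearD[OF lin] sl_linear_zero[OF lin] sl_linear_diff[OF lin] munit_sl munit_diff_sl
  note tr = sl_automorphism_rank_le_one(2)[OF F _ _ y]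
  obtain p :: 'n where True by simp
  show ?thesis
    using x
  proof (induction x rule: sl_induct[where p = p])
    case (off i j)
    then show ?case by (simp add: tr rank_le_one_munit)
  next
    case (diag i)
    \<comment> \<open>The rank-one nilpotent with column \<open>e_i + e_p\<close> and row
      \<open>e_i - e_p\<close>; it differs from the diagonal generator only by off-diagonal
      units.\<close>
    let ?r = "munit i i - munit p p + munit p i - munit i p"
    have sl: "?r \<in> sl" using diag by (intro diff_sl add_sl munit_diff_sl munit_sl) auto
    have "rank_le_one ?r" using diag by (auto simp: rank_le_one_def)
    then have "trace (F ?r ** F y) = trace (?r ** y)" by (rule tr[OF sl])
    moreover have "munit i i - munit p p = ?r - munit p i + munit i p" by simp
    ultimately show ?case
      using sl diag by (auto simp: diff_sl add_sl add_mmult diff_mmult trace_add trace_sub tr rank_le_one_munit)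
  qed (auto simp: add_mmult trace_add)
qed

text \<open>The properties of automorphisms that survive localisation; the classification below uses
  nothing else about \<open>D\<close>.\<close>

definition rank_one_isometry :: "(complex^'n^'n \<Rightarrow> complex^'n^'n) \<Rightarrow> bool" where
  "rank_one_isometry D \<longleftrightarrow> sl_linear D \<and> (\<forall>x\<in>sl. rank_le_one (D x) \<longleftrightarrow> rank_le_one x)
     \<and> (\<forall>x\<in>sl. \<forall>y\<in>sl. trace (D x ** D y) = trace (x ** y))"

lemma sl_automorphism_inv_into:
  assumes "sl_automorphism F" shows "sl_automorphism (inv_into sl F)"
proof -
  have lin: "sl_linear F" and bij: "bij_betw F sl sl"
    and br: "\<And>x y. x \<in> sl \<Longrightarrow> y \<in> sl \<Longrightarrow> F (lie_bracket x y) = lie_bracket (F x) (F y)"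
    using assms by (auto simp: sl_automorphism_def)
  let ?g = "inv_into sl F"
  have g: "?g z \<in> sl" "F (?g z) = z" if "z \<in> sl" for z
    using that bij by (auto simp: bij_betw_def inv_into_into f_inv_into_f)
  have eq: "?g z = x" if "F x = z" "x \<in> sl" for x z
    using that bij by (auto simp: bij_betw_def)
  have "sl_linear ?g"
    unfolding sl_linear_def
    by (intro conjI ballI allI eq) (simp_all add: g sl_linearD[OF lin] add_sl cscale_sl)
  moreover have "?g (lie_bracket x y) = lie_bracket (?g x) (?g y)" if "x \<in> sl" "y \<in> sl" for x y
    using that by (intro eq) (simp_all add: g br bracket_sl)
  ultimately show ?thesis
    using bij by (auto simp: sl_automorphism_def bij_betw_inv_into)
qed

text \<open>The rank condition involves one element at a time, and its converse comes from the
  inverse automorphism. Locally only the quadratic form \<open>trace (x ** x)\<close> is seen to be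
  preserved; linearity of \<open>D\<close> and polarisation give the bilinear form.\<close>

lemma rank_one_isometry_if_local_automorphism:
  assumes "sl_local_automorphism D"
  shows "rank_one_isometry D"
proof -
  have lin: "sl_linear D" and loc: "\<And>x. x \<in> sl \<Longrightarrow> \<exists>F. sl_automorphism F \<and> F x = D x"
    using assms by (auto simp: sl_local_automorphism_def)
  have rank: "rank_le_one (D x) \<longleftrightarrow> rank_le_one x" if x: "x \<in> sl" for x
  proof -
    obtain F where F: "sl_automorphism F" "F x = D x" using loc[OF x] by blast
    then have "inv_into sl F (D x) = x"
      using x by (metis bij_betw_inv_into_left sl_automorphism_def)
    then show ?thesis
      using sl_automorphism_rank_le_one(1)[OF F(1) x] F(2) sl_linearD(1)[OF lin x]
        sl_automorphism_rank_le_one(1)[OF sl_automorphism_inv_into[OF F(1)], of "D x"] by auto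
  qed
  have sq: "trace (D x ** D x) = trace (x ** x)" if x: "x \<in> sl" for x
    using loc[OF x] sl_automorphism_trace_mult[OF _ x x] by metis
  have "trace (D x ** D y) = trace (x ** y)" if x: "x \<in> sl" and y: "y \<in> sl" for x y
    using sq[OF add_sl[OF x y]] sq[OF x] sq[OF y]
    by (simp add: sl_linearD(2)[OF lin x y] matrix_add_ldistrib add_mmult trace_add
        trace_mul_sym[of y x] trace_mul_sym[of "D y" "D x"])
  with lin rank show ?thesis by (simp add: rank_one_isometry_def)
qed

section \<open>Linear maps preserving rank one and the trace form\<close>

definition outer :: "complex^'n \<Rightarrow> complex^'n \<Rightarrow> complex^'n^'n" where
  "outer u f = (\<chi> i j. u $ i * f $ j)"

lemma outer_nth [simp]: "outer u f $ i $ j = u $ i * f $ j"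
  by (simp add: outer_def)

lemma outer_zero [simp]: "outer 0 f = 0" "outer u 0 = 0"
  by (rule mat_eqI; simp)+

lemma rank_le_one_outer: "rank_le_one (outer u f)"
  by (simp add: rank_le_one_def ac_simps)

lemma rank_le_oneE:
  assumes "rank_le_one x" obtains u f where "x = outer u f"
proof (cases "x = 0")
  case True
  then have "x = outer 0 0" by simp
  then show ?thesis by (rule that)
next
  case False
  then obtain p q where pq: "x $ p $ q \<noteq> 0" by (metis mat_eqI zero_index)
  have "x = outer (\<chi> i. x $ i $ q) (\<chi> j. x $ p $ j / x $ p $ q)"
  proof (rule mat_eqI)
    fix i j
    show "x $ i $ j = outer (\<chi> i. x $ i $ q) (\<chi> j. x $ p $ j / x $ p $ q) $ i $ j"
      using rank_le_oneD[OF assms, of i j p q] pq by (simp add: field_simps)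
  qed
  then show ?thesis by (rule that)
qed

lemma mmult_outer_mmult: "b ** outer u f ** a = outer (b *v u) (f v* a)"
proof (rule mat_eqI)
  fix i j
  have "(b ** outer u f ** a) $ i $ j = (\<Sum>k\<in>UNIV. (\<Sum>l\<in>UNIV. b $ i $ l * u $ l) * (f $ k * a $ k $ j))"
    by (simp add: mmult_nth mult.assoc sum_distrib_right)
  also have "\<dots> = (b *v u) $ i * (f v* a) $ j"
    by (simp add: matrix_vector_mult_def vector_matrix_mult_def mult.commute[of "f $ _"] flip: sum_distrib_left)
  finally show "(b ** outer u f ** a) $ i $ j = outer (b *v u) (f v* a) $ i $ j" by simp
qed

lemma transpose_outer: "transpose (outer u f) = outer f u"
  by (rule mat_eqI) (simp add: mult.commute)

lemma trace_outer: "trace (outer u f) = (\<Sum>k\<in>UNIV. u $ k * f $ k)"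
  by (simp add: trace_def)

lemma trace_outer_mult_outer: "trace (outer u f ** outer v g) = trace (outer u g) * trace (outer v f)"
  unfolding trace_mult trace_outer sum_product by (simp add: ac_simps)

lemma rank_le_one_mmult: "rank_le_one x \<Longrightarrow> rank_le_one (b ** x ** a)"
  by (metis rank_le_oneE rank_le_one_outer mmult_outer_mmult)

lemma rank_le_one_transpose: "rank_le_one (transpose x) \<longleftrightarrow> rank_le_one x"
  by (metis rank_le_oneE rank_le_one_outer transpose_outer transpose_transpose)

text \<open>The zero vector is parallel to every vector, which is why transitivity asks for a
  nonzero middle vector.\<close>

definition parallel :: "complex^'n \<Rightarrow> complex^'n \<Rightarrow> bool" where
  "parallel u v \<longleftrightarrow> (\<forall>i j. u $ i * v $ j = u $ j * v $ i)"

lemma parallelE: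
  assumes "parallel u v" "v \<noteq> 0" obtains c where "u = c *s v"
proof -
  obtain p where "v $ p \<noteq> 0" using assms(2) by (auto simp: vec_eq_iff)
  then have "u = (u $ p / v $ p) *s v"
    using assms(1) by (auto simp: vec_eq_iff parallel_def field_simps)
  then show ?thesis by (rule that)
qed

lemma parallel_sym: "parallel u v \<Longrightarrow> parallel v u"
  by (auto simp: parallel_def ac_simps)

lemma parallel_trans: "parallel u v \<Longrightarrow> parallel v w \<Longrightarrow> v \<noteq> 0 \<Longrightarrow> parallel u w"
  by (elim parallelE[of u v]) (auto simp: parallel_def ac_simps mult.left_commute)

text \<open>Each 2 x 2 minor of the sum is a minor of the pair \<open>u\<close>, \<open>v\<close>
  times a minor of the pair \<open>f\<close>, \<open>g\<close>. The two index pairs vary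
  independently, so one family must vanish entirely.\<close>

lemma rank_le_one_outer_add_outer:
  "rank_le_one (outer u f + outer v g) \<longleftrightarrow> parallel u v \<or> parallel f g"
proof -
  have minor: "(outer u f + outer v g) $ a $ b * (outer u f + outer v g) $ c $ d
      - (outer u f + outer v g) $ a $ d * (outer u f + outer v g) $ c $ b
      = (u $ a * v $ c - u $ c * v $ a) * (f $ b * g $ d - f $ d * g $ b)" for a b c d
    by (simp add: algebra_simps)
  have "rank_le_one (outer u f + outer v g) \<longleftrightarrow>
      (\<forall>a b c d. (u $ a * v $ c - u $ c * v $ a) * (f $ b * g $ d - f $ d * g $ b) = 0)"
    unfolding rank_le_one_def minor[symmetric] by simp
  then show ?thesis unfolding parallel_def mult_eq_0_iff right_minus_eq by blast
qed

lemma rank_one_isometryD: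
  assumes "rank_one_isometry D"
  shows "sl_linear D" "x \<in> sl \<Longrightarrow> rank_le_one (D x) \<longleftrightarrow> rank_le_one x"
    "x \<in> sl \<Longrightarrow> y \<in> sl \<Longrightarrow> trace (D x ** D y) = trace (x ** y)"
  using assms by (auto simp: rank_one_isometry_def)

lemma rank_one_isometry_inj:
  assumes "rank_one_isometry D" "x \<in> sl" "D x = 0" shows "x = 0"
proof (rule trace_form_nondegenerate[OF assms(2)])
  fix y :: "complex^'a^'a" assume "y \<in> sl"
  then show "trace (x ** y) = 0"
    using rank_one_isometryD(3)[OF assms(1,2)] assms(3) by (simp add: trace_def)
qed

lemma rank_one_isometry_munit:
  assumes "rank_one_isometry D" "i \<noteq> j" shows "D (munit i j) \<noteq> 0"
proof
  assume "D (munit i j) = 0"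
  then have "munit i j = (0 :: complex^'a^'a)"
    using rank_one_isometry_inj[OF assms(1) munit_sl[OF assms(2)]] by simp
  then have "munit i j $ i $ j = (0 :: complex^'a^'a) $ i $ j" by simp
  then show False by simp
qed

text \<open>Allows the images of the matrix units to be moved into standard position;
  \<open>sl_conjugation_conj\<close> undoes the move.\<close>

lemma rank_one_isometry_conj:
  assumes D: "rank_one_isometry D" and ab: "a ** b = mat 1" "b ** a = mat 1"
  shows "rank_one_isometry (\<lambda>x. b ** D x ** a)"
proof -
  note lin = sl_linearD[OF rank_one_isometryD(1)[OF D]]
  have undo: "a ** (b ** x ** a) ** b = x" for x :: "complex^'a^'a"
    by (metis ab(1) matrix_mul_assoc matrix_mul_lid matrix_mul_rid)
  have rank: "rank_le_one (b ** x ** a) \<longleftrightarrow> rank_le_one x" for x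
    using rank_le_one_mmult[of x b a] rank_le_one_mmult[of "b ** x ** a" a b] by (auto simp: undo)
  have mult: "b ** x ** a ** (b ** y ** a) = b ** (x ** y) ** a" for x y
    by (metis ab(1) matrix_mul_assoc matrix_mul_rid)
  show ?thesis
    unfolding rank_one_isometry_def sl_linear_def
    using lin(1) rank_one_isometryD(2,3)[OF D]
    by (auto simp: sl_iff trace_conj[OF ab(1)] lin add_mmult matrix_add_ldistrib rank mult)
qed

lemma transpose_add: "transpose (x + y) = transpose x + transpose (y::complex^'n^'n)"
  by (rule mat_eqI) simp

lemma rank_one_isometry_transpose:
  assumes D: "rank_one_isometry D" shows "rank_one_isometry (\<lambda>x. transpose (D x))"
proof -
  note lin = sl_linearD[OF rank_one_isometryD(1)[OF D]]
  have "trace (transpose x ** transpose y) = trace (x ** y)" for x y :: "complex^'a^'a"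
    by (metis matrix_transpose_mul trace_transpose trace_mul_sym)
  then show ?thesis
    unfolding rank_one_isometry_def sl_linear_def
    using lin(1) rank_one_isometryD(2,3)[OF D]
    by (auto simp: sl_iff lin transpose_add transpose_cscale rank_le_one_transpose)
qed

section \<open>Recognising conjugations up to sign\<close>

definition sl_conjugation :: "(complex^'n^'n \<Rightarrow> complex^'n^'n) \<Rightarrow> bool" where
  "sl_conjugation D \<longleftrightarrow> (\<exists>a b \<epsilon>. a ** b = mat 1 \<and> b ** a = mat 1 \<and> \<epsilon> \<in> {1, -1}
     \<and> (\<forall>x\<in>sl. D x = cscale \<epsilon> (a ** x ** b)))"

lemma sl_conjugation_conj:
  assumes "sl_conjugation (\<lambda>x. b ** D x ** a)" and ab: "a ** b = mat 1" "b ** a = mat 1"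
  shows "sl_conjugation (D :: complex^'n^'n \<Rightarrow> complex^'n^'n)"
proof -
  obtain c d \<epsilon> where cd: "c ** d = mat 1" "d ** c = mat 1" and \<epsilon>: "\<epsilon> \<in> {1, -1}"
    and eq: "\<And>x. x \<in> sl \<Longrightarrow> b ** D x ** a = cscale \<epsilon> (c ** x ** d)"
    using assms(1) unfolding sl_conjugation_def by blast
  have "D x = cscale \<epsilon> ((a ** c) ** x ** (d ** b))" if "x \<in> sl" for x
  proof -
    have "D x = a ** (b ** D x ** a) ** b" by (metis ab(1) matrix_mul_assoc matrix_mul_lid matrix_mul_rid)
    then show ?thesis by (simp add: eq[OF that] matrix_mul_assoc)
  qed
  moreover have "(a ** c) ** (d ** b) = mat 1" "(d ** b) ** (a ** c) = mat 1"
    by (metis ab cd matrix_mul_assoc matrix_mul_rid)+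
  ultimately show ?thesis using \<epsilon> unfolding sl_conjugation_def by blast
qed

definition diagm :: "('n \<Rightarrow> complex) \<Rightarrow> complex^'n^'n" where
  "diagm f = (\<chi> i j. if i = j then f i else 0)"

lemma diagm_mmult_nth [simp]: "(diagm f ** x) $ i $ j = f i * x $ i $ j"
proof -
  have "(diagm f ** x) $ i $ j = (\<Sum>k\<in>UNIV. if k = i then f k * x $ k $ j else 0)"
    unfolding mmult_nth by (rule sum.cong) (auto simp: diagm_def)
  then show ?thesis by simp
qed

lemma mmult_diagm_nth [simp]: "(x ** diagm f) $ i $ j = x $ i $ j * f j"
proof -
  have "(x ** diagm f) $ i $ j = (\<Sum>k\<in>UNIV. if k = j then x $ i $ k * f k else 0)"
    unfolding mmult_nth by (rule sum.cong) (auto simp: diagm_def)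
  then show ?thesis by simp
qed

lemma diagm_mmult_diagm: "(\<And>i. f i * g i = 1) \<Longrightarrow> diagm f ** diagm g = mat 1"
  by (rule mat_eqI) (auto simp: diagm_def[of g] mat_def)

text \<open>Suitable rank-one test matrices tie the scalars \<open>c i j\<close> to the images
  \<open>h i\<close> of the diagonal generators. Everything is then determined by a single sign,
  which conjugation by a diagonal matrix of signs and a global sign reproduce.\<close>

lemma sl_conjugation_if_fixes_row:
  fixes D :: "complex^'n^'n \<Rightarrow> complex^'n^'n"
  assumes D: "rank_one_isometry D"
    and c: "\<And>i j. i \<noteq> j \<Longrightarrow> D (munit i j) = cscale (c i j) (munit i j)"
    and row: "\<And>j. j \<noteq> p \<Longrightarrow> c p j = 1"
    and card: "q \<noteq> p"
  shows "sl_conjugation D"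
proof -
  note lin = sl_linearD[OF rank_one_isometryD(1)[OF D]] sl_linear_diff[OF rank_one_isometryD(1)[OF D]]
  have cc: "c i j * c j i = 1" if "i \<noteq> j" for i j
    using rank_one_isometryD(3)[OF D munit_sl munit_sl, of i j j i] that
    by (simp add: c trace_mult_munit mult.commute)
  have col: "c j p = 1" if "j \<noteq> p" for j
    using cc[of j p] row[OF that] that by simp
  define h where "h i = D (munit i i - munit p p)" for i
  define s where "s i = h i $ i $ i" for i
  have off: "h i $ j $ k = 0" if "j \<noteq> k" for i j k
  proof -
    have "trace (h i ** D (munit k j)) = 0"
      using that rank_one_isometryD(3)[OF D munit_diff_sl munit_sl, of k j i p]
      by (auto simp: h_def trace_mult_munit)
    moreover have "c k j \<noteq> 0" using cc[of k j] that by auto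
    ultimately show ?thesis using that by (simp add: c trace_mult_munit)
  qed
  have h: "h i = cscale (s i) (munit i i - munit p p)" and ss: "s i * s i = 1" if ip: "i \<noteq> p" for i
  proof -
    \<comment> \<open>Column \<open>e_i + e_p\<close> times row \<open>e_p - e_i\<close>. The minors
      of its image kill the remaining diagonal entries of \<open>h i\<close> and give
      \<open>s i * s i = 1\<close>.\<close>
    let ?x = "munit i p - munit p i - (munit i i - munit p p)"
    have x: "?x \<in> sl" using ip by (intro diff_sl munit_diff_sl munit_sl) auto
    moreover have "rank_le_one ?x" using ip by (auto simp: rank_le_one_def)
    moreover have "D ?x = munit i p - munit p i - h i"
      using ip by (simp add: lin diff_sl munit_sl munit_diff_sl c row col h_def)
    ultimately have r: "rank_le_one (munit i p - munit p i - h i)"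
      using rank_one_isometryD(2)[OF D x] by simp
    have zero: "h i $ k $ k = 0" if "k \<noteq> i" "k \<noteq> p" for k
      using rank_le_oneD[OF r, of p i k k] that ip by (simp add: off)
    have "trace (h i) = h i $ i $ i + h i $ p $ p"
    proof -
      have "trace (h i) = (\<Sum>k\<in>{i, p}. h i $ k $ k)"
        unfolding trace_def by (rule sum.mono_neutral_right) (auto simp: zero)
      then show ?thesis using ip by simp
    qed
    moreover have "trace (h i) = 0"
      using lin(1)[OF munit_diff_sl] by (simp add: h_def sl_iff)
    ultimately have hp: "h i $ p $ p = - s i" by (simp add: s_def add_eq_0_iff)
    show "h i = cscale (s i) (munit i i - munit p p)"
    proof (rule mat_eqI)
      fix j k
      show "h i $ j $ k = cscale (s i) (munit i i - munit p p) $ j $ k"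
        using off[of j k i] zero[of j] hp ip by (cases "j = k") (auto simp: s_def)
    qed
    show "s i * s i = 1"
      using rank_le_oneD[OF r, of i i p p] ip hp by (simp add: off s_def)
  qed
  have cs: "c i j = s i" if ij: "i \<noteq> j" "i \<noteq> p" "j \<noteq> p" for i j
  proof -
    \<comment> \<open>Column \<open>e_p + e_i\<close> times row \<open>e_j + e_p - e_i\<close>; the
      minor of its image in rows \<open>p\<close>, \<open>i\<close> and columns \<open>j\<close>,
      \<open>i\<close> yields \<open>c i j = s i\<close>.\<close>
    let ?x = "munit p j + munit i j + munit i p - munit p i - (munit i i - munit p p)"
    have x: "?x \<in> sl" using ij by (intro diff_sl add_sl munit_diff_sl munit_sl) auto
    have "?x = outer (\<chi> a. if a = p \<or> a = i then 1 else 0)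
        (\<chi> b. if b = j \<or> b = p then 1 else if b = i then - 1 else 0)"
      using ij by (intro mat_eqI) auto
    then have "rank_le_one ?x" by (simp only: rank_le_one_outer)
    moreover have "D ?x = munit p j + cscale (c i j) (munit i j) + munit i p - munit p i - h i"
      using ij by (simp add: lin diff_sl add_sl munit_sl munit_diff_sl c row col h_def)
    ultimately have r: "rank_le_one (munit p j + cscale (c i j) (munit i j) + munit i p - munit p i - h i)"
      using rank_one_isometryD(2)[OF D x] by simp
    show ?thesis
      using rank_le_oneD[OF r, of p j i i] ij by (simp add: h[OF ij(2)])
  qed
  \<comment> \<open>\<open>s i * s q = c i q * c q i = 1\<close>, and both factors are
    signs.\<close>
  have s_const: "s i = s q" if "i \<noteq> p" for i
  proof (cases "i = q")
    case False
    then have "s i * s q = 1" using cc[of i q] cs[of i q] cs[of q i] that card by simp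
    then show ?thesis using ss[OF that] by (metis mult_cancel_left mult_zero_left zero_neq_one)
  qed simp
  \<comment> \<open>The entry \<open>s q\<close> at \<open>p\<close> cancels the global sign in row
    and column \<open>p\<close>, where the scalars are 1.\<close>
  define \<delta> where "\<delta> i = (if i = p then s q else 1)" for i
  define d where "d = diagm \<delta>"
  have \<delta>: "\<delta> i * \<delta> i = 1" for i by (simp add: \<delta>_def ss card)
  then have dd: "d ** d = mat 1"
    unfolding d_def by (rule diagm_mmult_diagm)
  have c_eq: "c i j = s q * (\<delta> i * \<delta> j)" if "i \<noteq> j" for i j
  proof (cases "i = p \<or> j = p")
    case True
    then show ?thesis using that row[of j] col[of i] ss[OF card] by (auto simp: \<delta>_def)
  next
    case False
    then show ?thesis using that cs[of i j] s_const[of i] by (simp add: \<delta>_def)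
  qed
  have d_munit: "d ** munit i j ** d = cscale (\<delta> i * \<delta> j) (munit i j)" for i j
    by (rule mat_eqI) (simp add: d_def)
  have "D x = cscale (s q) (d ** x ** d)" if "x \<in> sl" for x
    using that
  proof (induction x rule: sl_induct[where p = p])
    case (off i j)
    then show ?case by (simp add: d_munit c c_eq)
  next
    case (diag i)
    then show ?case
      using h[of i] by (simp add: mmult_diff diff_mmult d_munit \<delta> s_const h_def)
  qed (auto simp: lin add_mmult matrix_add_ldistrib cscale_add mult.commute sl_linear_zero[OF rank_one_isometryD(1)[OF D]])
  moreover have "s q \<in> {1, -1}" using ss[OF card] by (simp add: square_eq_1_iff)
  ultimately show ?thesis using dd unfolding sl_conjugation_def by blast
qed

text \<open>Conjugation by the diagonal matrix with entries \<open>c p j\<close>, and 1 at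
  \<open>p\<close>, normalises the scalars of row \<open>p\<close> to 1.\<close>

lemma sl_conjugation_if_scales_munits:
  fixes D :: "complex^'n^'n \<Rightarrow> complex^'n^'n"
  assumes D: "rank_one_isometry D"
    and c: "\<And>i j. i \<noteq> j \<Longrightarrow> D (munit i j) = cscale (c i j) (munit i j)"
    and card: "q \<noteq> (p :: 'n)"
  shows "sl_conjugation D"
proof -
  have nz: "c i j \<noteq> 0" if "i \<noteq> j" for i j
    using rank_one_isometryD(3)[OF D munit_sl munit_sl, of i j j i] that
    by (auto simp: c trace_mult_munit)
  define f where "f j = (if j = p then 1 else c p j)" for j
  define g where "g j = 1 / f j" for j
  have fg: "f j * g j = 1" for j using nz[of p j] by (auto simp: f_def g_def)
  define a where "a = diagm g"
  define b where "b = diagm f"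
  have ab: "a ** b = mat 1" "b ** a = mat 1"
    using fg by (auto simp: a_def b_def mult.commute intro!: diagm_mmult_diagm)
  have "sl_conjugation (\<lambda>x. b ** D x ** a)"
  proof (rule sl_conjugation_if_fixes_row[OF rank_one_isometry_conj[OF D ab], where c = "\<lambda>i j. f i * c i j * g j" and p = p])
    show "b ** D (munit i j) ** a = cscale (f i * c i j * g j) (munit i j)" if "i \<noteq> j" for i j
      using c[OF that] by (intro mat_eqI) (simp add: a_def b_def)
    show "f p * c p j * g j = 1" if "j \<noteq> p" for j
      using that fg[of j] by (simp add: f_def)
  qed (rule card)
  then show ?thesis by (rule sl_conjugation_conj[OF _ ab])
qed

text \<open>Preservation of the trace form and tracelessness of the images make the
  \<open>H j\<close>, up to scaling, the dual basis of the \<open>V i\<close>. In this basis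
  \<open>D\<close> merely scales the off-diagonal units.\<close>

lemma sl_conjugation_if_frame:
  fixes D :: "complex^'n^'n \<Rightarrow> complex^'n^'n"
  assumes D: "rank_one_isometry D"
    and VH: "\<And>i j. i \<noteq> j \<Longrightarrow> D (munit i j) = cscale (c i j) (outer (V i) (H j))"
    and card: "q \<noteq> (p :: 'n)"
  shows "sl_conjugation D"
proof -
  define e where "e i j = trace (outer (V i) (H j))" for i j
  have tr: "c i j * c j i * (e i i * e j j) = 1" if "i \<noteq> j" for i j
    using rank_one_isometryD(3)[OF D munit_sl munit_sl, of i j j i] that
    by (simp add: VH trace_outer_mult_outer e_def trace_mult_munit mult.commute[of "c j i"])
  have off: "e i j = 0" if "i \<noteq> j" for i j
    using sl_linearD(1)[OF rank_one_isometryD(1)[OF D] munit_sl[OF that]] tr[OF that] that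
    by (auto simp: VH sl_iff e_def)
  have e: "e i i \<noteq> 0" for i
  proof -
    obtain j where "i \<noteq> j" using card by metis
    from tr[OF this] show ?thesis by auto
  qed
  \<comment> \<open>The columns of \<open>a\<close> are the \<open>V i\<close>; the rows of
    \<open>b\<close> are the \<open>H i\<close>, scaled to pair to 1 with them.\<close>
  define a where "a = (\<chi> k i. V i $ k)"
  define b where "b = (\<chi> i k. H i $ k / e i i)"
  have ba: "b ** a = mat 1"
  proof (rule mat_eqI)
    fix i j
    have "(b ** a) $ i $ j = e j i / e i i"
      by (simp add: mmult_nth a_def b_def e_def trace_outer sum_divide_distrib mult.commute)
    then show "(b ** a) $ i $ j = mat 1 $ i $ j"
      using off[of j i] e by (auto simp: mat_def)
  qed
  then have ab: "a ** b = mat 1" by (simp add: matrix_left_right_inverse)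
  have bV: "b *v V i = axis i 1" for i
  proof -
    have "V i = a *v axis i 1" 
      by (simp add: a_def vec_eq_iff matrix_vector_mult_def axis_def if_distrib[of "(*) _"] cong: if_cong)
    then show ?thesis by (simp add: matrix_vector_mul_assoc ba)
  qed
  have Ha: "H j v* a = e j j *s axis j 1" for j
  proof -
    have "(H j v* a) $ k = e k j" for k
      by (simp add: vector_matrix_mult_def a_def e_def trace_outer mult.commute)
    then show ?thesis using off by (auto simp: vec_eq_iff axis_def)
  qed
  have "sl_conjugation (\<lambda>x. b ** D x ** a)"
  proof (rule sl_conjugation_if_scales_munits[OF rank_one_isometry_conj[OF D ab ba] _ card])
    show "b ** D (munit i j) ** a = cscale (c i j * e j j) (munit i j)" if "i \<noteq> j" for i j
      unfolding VH[OF that] by (simp add: mmult_outer_mmult bV Ha) (auto simp: vec_eq_iff axis_def)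
  qed
  then show ?thesis by (rule sl_conjugation_conj[OF _ ab ba])
qed

text \<open>The column space of the image of \<open>munit i j\<close> depends only on
  \<open>i\<close> and its row space only on \<open>j\<close>, so one representative of each gives a
  frame.\<close>

lemma sl_conjugation_if_parallel:
  fixes D :: "complex^'n^'n \<Rightarrow> complex^'n^'n"
  assumes D: "rank_one_isometry D"
    and vg: "\<And>i j. i \<noteq> j \<Longrightarrow> D (munit i j) = outer (v i j) (g i j)"
    and v: "\<And>i j k. i \<noteq> j \<Longrightarrow> i \<noteq> k \<Longrightarrow> j \<noteq> k \<Longrightarrow> parallel (v i j) (v i k)"
    and g: "\<And>i j k. i \<noteq> j \<Longrightarrow> i \<noteq> k \<Longrightarrow> j \<noteq> k \<Longrightarrow> parallel (g j i) (g k i)"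
    and card: "q \<noteq> (p :: 'n)"
  shows "sl_conjugation D"
proof -
  have nz: "v i j \<noteq> 0" "g i j \<noteq> 0" if "i \<noteq> j" for i j
    using rank_one_isometry_munit[OF D that] by (auto simp: vg[OF that])
  \<comment> \<open>An arbitrary off-diagonal reference position \<open>(i, r i)\<close> in row
    \<open>i\<close>, and \<open>(r j, j)\<close> in column \<open>j\<close>.\<close>
  obtain r :: "'n \<Rightarrow> 'n" where r: "\<And>i. r i \<noteq> i"
    using card that[of "\<lambda>i. if i = p then q else p"] by auto
  have "\<exists>c. D (munit i j) = cscale c (outer (v i (r i)) (g (r j) j))" if ij: "i \<noteq> j" for i j
  proof -
    have "parallel (v i j) (v i (r i))"
      using v[of i j "r i"] ij r[of i] by (cases "j = r i") (auto simp: parallel_def)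
    then obtain \<alpha> where \<alpha>: "v i j = \<alpha> *s v i (r i)"
      using nz(1) r by (metis parallelE)
    have "parallel (g i j) (g (r j) j)"
      using g[of j i "r j"] ij r[of j] by (cases "i = r j") (auto simp: parallel_def)
    then obtain \<beta> where \<beta>: "g i j = \<beta> *s g (r j) j"
      using nz(2) r by (metis parallelE)
    have "D (munit i j) = cscale (\<alpha> * \<beta>) (outer (v i (r i)) (g (r j) j))"
      unfolding vg[OF ij] \<alpha> \<beta> by (rule mat_eqI) simp
    then show ?thesis ..
  qed
  then obtain c where "\<And>i j. i \<noteq> j \<Longrightarrow> D (munit i j) = cscale (c i j) (outer (v i (r i)) (g (r j) j))"
    by metis
  then show ?thesis by (rule sl_conjugation_if_frame[OF D _ card])
qed

text \<open>
  \<open>C i j k l\<close> and \<open>R i j k l\<close> compare the positions \<open>(i, j)\<close> and \<open>(k, l)\<close>: the images of the two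
  matrix units share their column space, respectively their row space. Since positions in
  different rows and columns share neither, the type flips whenever a path turns from a row
  into a column.
\<close>

lemma off_diagonal_types:
  fixes C R :: "'n \<Rightarrow> 'n \<Rightarrow> 'n \<Rightarrow> 'n \<Rightarrow> bool"
  assumes sym: "\<And>i j k l. C i j k l \<Longrightarrow> C k l i j" "\<And>i j k l. R i j k l \<Longrightarrow> R k l i j"
    and trans: "\<And>i j k l m n. k \<noteq> l \<Longrightarrow> C i j k l \<Longrightarrow> C k l m n \<Longrightarrow> C i j m n"
      "\<And>i j k l m n. k \<noteq> l \<Longrightarrow> R i j k l \<Longrightarrow> R k l m n \<Longrightarrow> R i j m n"
    and row: "\<And>i j k. i \<noteq> j \<Longrightarrow> i \<noteq> k \<Longrightarrow> j \<noteq> k \<Longrightarrow> C i j i k \<noteq> R i j i k"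
    and col: "\<And>i j k. i \<noteq> j \<Longrightarrow> i \<noteq> k \<Longrightarrow> j \<noteq> k \<Longrightarrow> C j i k i \<noteq> R j i k i"
    and far: "\<And>i j k l. i \<noteq> j \<Longrightarrow> k \<noteq> l \<Longrightarrow> i \<noteq> k \<Longrightarrow> j \<noteq> l \<Longrightarrow> \<not> C i j k l \<and> \<not> R i j k l"
  shows "(\<forall>i j k. i \<noteq> j \<longrightarrow> i \<noteq> k \<longrightarrow> j \<noteq> k \<longrightarrow> C i j i k \<and> R j i k i)
    \<or> (\<forall>i j k. i \<noteq> j \<longrightarrow> i \<noteq> k \<longrightarrow> j \<noteq> k \<longrightarrow> R i j i k \<and> C j i k i)"
proof -
  \<comment> \<open>If both legs of the turn had the same type, transitivity would relate
    \<open>(i, j)\<close> to \<open>(l, k)\<close>, which differ in row and column.\<close>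
  have turn: "C i j i k \<longleftrightarrow> R i k l k"
    if "i \<noteq> j" "i \<noteq> k" "j \<noteq> k" "l \<noteq> i" "l \<noteq> k" for i j k l
    using row[of i j k] col[of k i l] far[of i j l k] trans[of i k i j l k] that by metis
  \<comment> \<open>The type of position \<open>(i, k)\<close>: whether it shares its column space
    with the rest of its row. It is constant along rows and columns.\<close>
  define T where "T i k \<longleftrightarrow> (\<forall>j. j \<noteq> i \<longrightarrow> j \<noteq> k \<longrightarrow> C i j i k)" for i k
  have T: "T i k \<longleftrightarrow> C i j i k" if "i \<noteq> j" "i \<noteq> k" "j \<noteq> k" for i j k
    unfolding T_def using turn[of i _ k j] that by metis
  have T_row: "T i k \<longleftrightarrow> T i j" if "i \<noteq> j" "i \<noteq> k" "j \<noteq> k" for i j k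
    using T[of i j k] T[of i k j] sym(1) that by metis
  have T_col: "T i k \<longleftrightarrow> T l k" if "i \<noteq> k" "l \<noteq> k" "i \<noteq> l" for i k l
    using T[of i l k] T[of l i k] turn[of i l k l] turn[of l i k i] sym(2) that by metis
  have R: "R j i k i \<longleftrightarrow> T j i" if "i \<noteq> j" "i \<noteq> k" "j \<noteq> k" for i j k
    using T[of j k i] turn[of j k i k] that by metis
  show ?thesis
  proof (cases "\<exists>i j k. i \<noteq> j \<and> i \<noteq> k \<and> j \<noteq> k \<and> T i k")
    case True
    then obtain i j k where ijk: "i \<noteq> j" "i \<noteq> k" "j \<noteq> k" "T i k" by blast
    have "T a b" if "a \<noteq> b" for a b
    proof -
      \<comment> \<open>From \<open>(i, k)\<close> move along column \<open>k\<close> to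
        \<open>(a, k)\<close>, then along row \<open>a\<close> to \<open>(a, b)\<close>.\<close>
      have *: "T a b" if "a \<noteq> k" "a \<noteq> b" for a b
        using that ijk T_col[of i k a] T_row[of a k b] by metis
      show ?thesis
      proof (cases "a = k")
        case True
        \<comment> \<open>Row \<open>k\<close> cannot be reached through column \<open>k\<close>, so
          the path goes through a third row \<open>m\<close> and then along column
          \<open>b\<close>.\<close>
        obtain m where "m \<noteq> a" "m \<noteq> b" using ijk by metis
        then show ?thesis using * [of m b] T_col[of m b a] True that by metis
      qed (use * that in blast)
    qed
    then show ?thesis using T R by metis
  next
    case False
    then show ?thesis using T R row col by metis
  qed
qed

text \<open>Units in a common row or column have a sum of rank one, so their images share a column
  space or a row space, and by injectivity not both; other pairs share neither. If rows share row
  spaces, transposing the images reduces to the opposite case.\<close>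

lemma rank_one_isometry_classification:
  fixes D :: "complex^'n^'n \<Rightarrow> complex^'n^'n"
  assumes D: "rank_one_isometry D" and card: "q \<noteq> (p :: 'n)"
  shows "sl_conjugation D \<or> sl_conjugation (\<lambda>x. transpose (D x))"
proof -
  note lin = sl_linearD[OF rank_one_isometryD(1)[OF D]] sl_linear_diff[OF rank_one_isometryD(1)[OF D]]
  have "\<exists>u f. i \<noteq> j \<longrightarrow> D (munit i j) = outer u f" for i j
    using rank_one_isometryD(2)[OF D munit_sl] rank_le_one_munit rank_le_oneE by metis
  then obtain v g where vg: "\<And>i j. i \<noteq> j \<Longrightarrow> D (munit i j) = outer (v i j) (g i j)"
    by metis
  have nz: "v i j \<noteq> 0" "g i j \<noteq> 0" if "i \<noteq> j" for i j
    using rank_one_isometry_munit[OF D that] by (auto simp: vg[OF that])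
  have adj: "parallel (v i j) (v k l) \<or> parallel (g i j) (g k l) \<longleftrightarrow> rank_le_one (munit i j + munit k l :: complex^'n^'n)"
    if "i \<noteq> j" "k \<noteq> l" for i j k l
    using rank_one_isometryD(2)[OF D add_sl[OF munit_sl munit_sl], of i j k l] that
    by (simp add: lin munit_sl vg rank_le_one_outer_add_outer)
  have excl: "\<not> (parallel (v i j) (v k l) \<and> parallel (g i j) (g k l))"
    if ne: "i \<noteq> j" "k \<noteq> l" "(i, j) \<noteq> (k, l)" for i j k l
  proof
    assume "parallel (v i j) (v k l) \<and> parallel (g i j) (g k l)"
    then obtain \<alpha> \<beta> where "v i j = \<alpha> *s v k l" "g i j = \<beta> *s g k l"
      using nz ne by (metis parallelE)
    then have "D (munit i j - cscale (\<alpha> * \<beta>) (munit k l)) = 0"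
      using ne by (simp add: lin munit_sl cscale_sl vg vec_eq_iff)
    then have "munit i j - cscale (\<alpha> * \<beta>) (munit k l) = (0 :: complex^'n^'n)"
      using rank_one_isometry_inj[OF D diff_sl[OF munit_sl cscale_sl[OF munit_sl]]] ne by blast
    then have "(munit i j - cscale (\<alpha> * \<beta>) (munit k l) :: complex^'n^'n) $ i $ j = 0" by simp
    then show False using ne by auto
  qed
  define C where "C i j k l \<longleftrightarrow> i \<noteq> j \<and> k \<noteq> l \<and> parallel (v i j) (v k l)" for i j k l
  define R where "R i j k l \<longleftrightarrow> i \<noteq> j \<and> k \<noteq> l \<and> parallel (g i j) (g k l)" for i j k l
  have "(\<forall>i j k. i \<noteq> j \<longrightarrow> i \<noteq> k \<longrightarrow> j \<noteq> k \<longrightarrow> C i j i k \<and> R j i k i)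
    \<or> (\<forall>i j k. i \<noteq> j \<longrightarrow> i \<noteq> k \<longrightarrow> j \<noteq> k \<longrightarrow> R i j i k \<and> C j i k i)"
  proof (rule off_diagonal_types)
    fix i j k l m n
    show "C i j k l \<Longrightarrow> C k l i j" "R i j k l \<Longrightarrow> R k l i j"
      by (auto simp: C_def R_def intro: parallel_sym)
    show "k \<noteq> l \<Longrightarrow> C i j k l \<Longrightarrow> C k l m n \<Longrightarrow> C i j m n"
      "k \<noteq> l \<Longrightarrow> R i j k l \<Longrightarrow> R k l m n \<Longrightarrow> R i j m n"
      using nz parallel_trans unfolding C_def R_def by blast+
    show "C i j i k \<noteq> R i j i k" if "i \<noteq> j" "i \<noteq> k" "j \<noteq> k"
    proof -
      have "rank_le_one (munit i j + munit i k :: complex^'n^'n)" by (auto simp: rank_le_one_def)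
      then show ?thesis using adj[of i j i k] excl[of i j i k] that by (auto simp: C_def R_def)
    qed
    show "C j i k i \<noteq> R j i k i" if "i \<noteq> j" "i \<noteq> k" "j \<noteq> k"
    proof -
      have "rank_le_one (munit j i + munit k i :: complex^'n^'n)" by (auto simp: rank_le_one_def)
      then show ?thesis using adj[of j i k i] excl[of j i k i] that by (auto simp: C_def R_def)
    qed
    show "\<not> C i j k l \<and> \<not> R i j k l" if "i \<noteq> j" "k \<noteq> l" "i \<noteq> k" "j \<noteq> l"
    proof -
      have "\<not> rank_le_one (munit i j + munit k l :: complex^'n^'n)"
        using rank_le_oneD[of "munit i j + munit k l :: complex^'n^'n" i j k l] that by auto
      then show ?thesis using adj[of i j k l] that by (auto simp: C_def R_def)
    qed
  qed
  then show ?thesis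
  proof
    assume "\<forall>i j k. i \<noteq> j \<longrightarrow> i \<noteq> k \<longrightarrow> j \<noteq> k \<longrightarrow> C i j i k \<and> R j i k i"
    then have "sl_conjugation D"
      by (intro sl_conjugation_if_parallel[OF D vg _ _ card]) (auto simp: C_def R_def)
    then show ?thesis ..
  next
    assume *: "\<forall>i j k. i \<noteq> j \<longrightarrow> i \<noteq> k \<longrightarrow> j \<noteq> k \<longrightarrow> R i j i k \<and> C j i k i"
    have "sl_conjugation (\<lambda>x. transpose (D x))"
      using * by (intro sl_conjugation_if_parallel[OF rank_one_isometry_transpose[OF D], where v = g and g = v, OF _ _ _ card])
        (auto simp: C_def R_def vg transpose_outer)
    then show ?thesis ..
  qed
qed

section \<open>The converse: constructing automorphisms that agree at a point\<close>

lemma matrix_inv_eqI: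
  fixes a :: "complex^'n^'n"
  assumes "a ** b = mat 1" "b ** a = mat 1"
  shows "invertible a" "matrix_inv a = b"
proof -
  show "invertible a" unfolding invertible_def using assms by blast
  have "a ** matrix_inv a = mat 1 \<and> matrix_inv a ** a = mat 1"
    unfolding matrix_inv_def by (rule someI[of _ b]) (simp add: assms)
  then show "matrix_inv a = b" by (metis assms(2) matrix_mul_assoc matrix_mul_lid matrix_mul_rid)
qed

lemma sl_automorphismI:
  fixes F :: "complex^'n^'n \<Rightarrow> complex^'n^'n"
  assumes "\<And>x. x \<in> sl \<Longrightarrow> F x \<in> sl" "\<And>x y. F (x + y) = F x + F y" "\<And>c x. F (cscale c x) = cscale c (F x)"
    "\<And>x y. F (lie_bracket x y) = lie_bracket (F x) (F y)"
    "\<And>x. x \<in> sl \<Longrightarrow> G x \<in> sl" "\<And>x. F (G x) = x" "\<And>x. G (F x) = x"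
  shows "sl_automorphism F"
  unfolding sl_automorphism_def sl_linear_def
  using assms by (auto intro!: bij_betw_byWitness[where f' = G])

lemma sl_automorphism_conj:
  fixes a b :: "complex^'n^'n"
  assumes ab: "a ** b = mat 1" "b ** a = mat 1"
  shows "sl_automorphism (\<lambda>x. a ** x ** b)"
proof -
  have undo: "a ** (b ** x ** a) ** b = x" "b ** (a ** x ** b) ** a = x" for x
    by (metis ab matrix_mul_assoc matrix_mul_lid matrix_mul_rid)+
  have mult: "a ** x ** b ** (a ** y ** b) = a ** (x ** y) ** b" for x y
    by (metis ab(2) matrix_mul_assoc matrix_mul_rid)
  show ?thesis
    by (rule sl_automorphismI[where G = "\<lambda>x. b ** x ** a"])
      (auto simp: sl_iff trace_conj ab undo lie_bracket_def mmult_diff diff_mmult matrix_add_ldistrib add_mmult mult)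
qed

text \<open>Transposition reverses products and hence brackets; the sign repairs this.\<close>

lemma sl_automorphism_neg_transpose:
  "sl_automorphism (\<lambda>x :: complex^'n^'n. cscale (-1) (transpose x))"
proof -
  have "transpose (x - y) = transpose x - transpose (y :: complex^'n^'n)" for x y
    by (rule mat_eqI) simp
  then show ?thesis
    by (intro sl_automorphismI[where G = "\<lambda>x. cscale (-1) (transpose x)"])
      (auto simp: sl_iff lie_bracket_def matrix_transpose_mul transpose_add transpose_cscale cscale_add cscale_diff mult.commute
        intro!: mat_eqI)
qed

lemma sl_automorphism_comp:
  assumes "sl_automorphism F" "sl_automorphism G"
  shows "sl_automorphism (\<lambda>x. F (G x))"
  using assms bij_betw_trans[of G sl sl F sl]
  unfolding sl_automorphism_def sl_linear_def by (auto simp: comp_def)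

text \<open>\<open>a x b\<close> and \<open>- a x^t b\<close> are automorphisms. For the other two
  maps, a similarity between \<open>x\<close> and its transpose, depending on \<open>x\<close>,
  trades one for the other and yields an automorphism with the same value at
  \<open>x\<close>.\<close>

lemma sl_local_automorphism_if_conjugation:
  fixes D :: "complex^'n^'n \<Rightarrow> complex^'n^'n"
  assumes lin: "sl_linear D" and ab: "a ** b = mat 1" "b ** a = mat 1" and \<epsilon>: "\<epsilon> \<in> {1, -1}"
    and D: "(\<forall>x\<in>sl. D x = cscale \<epsilon> (a ** x ** b)) \<or> (\<forall>x\<in>sl. D x = cscale \<epsilon> (a ** transpose x ** b))"
  shows "sl_local_automorphism D"
  unfolding sl_local_automorphism_def
proof (intro conjI ballI lin)
  fix x :: "complex^'n^'n" assume x: "x \<in> sl"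
  obtain p q where pq: "p ** q = mat 1" "q ** p = mat 1" and xt: "x = p ** transpose x ** q"
    using matrix_similar_transpose by blast
  have xt': "transpose x = q ** x ** p"
    by (subst (2) xt) (metis pq(2) matrix_mul_assoc matrix_mul_lid matrix_mul_rid)
  have apq: "(a ** p) ** (q ** b) = mat 1" "(q ** b) ** (a ** p) = mat 1"
    and aqp: "(a ** q) ** (p ** b) = mat 1" "(p ** b) ** (a ** q) = mat 1"
    by (metis ab pq matrix_mul_assoc matrix_mul_rid)+
  note conj = sl_automorphism_conj[OF ab] sl_automorphism_conj[OF apq] sl_automorphism_conj[OF aqp]
  note neg = conj[THEN sl_automorphism_comp, OF sl_automorphism_neg_transpose]
  have "a ** x ** b = (a ** p) ** transpose x ** (q ** b)"
    by (subst xt) (simp add: matrix_mul_assoc)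
  moreover have "a ** transpose x ** b = (a ** q) ** x ** (p ** b)"
    by (subst xt') (simp add: matrix_mul_assoc)
  ultimately consider "D x = a ** x ** b" | "D x = (a ** q) ** x ** (p ** b)"
    | "D x = a ** cscale (-1) (transpose x) ** b"
    | "D x = (a ** p) ** cscale (-1) (transpose x) ** (q ** b)"
    using D x \<epsilon> by fastforce
  then show "\<exists>F. sl_automorphism F \<and> F x = D x"
    using conj neg by cases metis+
qed

theorem theorem2p3:
  fixes D :: "complex^'n^'n \<Rightarrow> complex^'n^'n"
  assumes "CARD('n) \<ge> 2"
    and "sl_linear D"
  shows "sl_local_automorphism D \<longleftrightarrow>
    (\<exists>(a::complex^'n^'n) (\<epsilon>::complex). invertible a \<and> \<epsilon> \<in> {1, -1} \<and>
       ((\<forall>x\<in>sl. D x = cscale \<epsilon> (a ** x ** matrix_inv a)) \<or>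
        (\<forall>x\<in>sl. D x = cscale \<epsilon> (a ** transpose x ** matrix_inv a))))"
    (is "_ \<longleftrightarrow> ?rhs")
proof
  assume "sl_local_automorphism D"
  then have D: "rank_one_isometry D" by (rule rank_one_isometry_if_local_automorphism)
  obtain p q :: 'n where "q \<noteq> p"
    using assms(1) card_le_Suc0_iff_eq[of "UNIV :: 'n set"] by force
  from rank_one_isometry_classification[OF D this] show ?rhs
  proof
    assume "sl_conjugation D"
    then show ?rhs unfolding sl_conjugation_def using matrix_inv_eqI by metis
  next
    assume "sl_conjugation (\<lambda>x. transpose (D x))"
    then obtain a b \<epsilon> where ab: "a ** b = mat 1" "b ** a = mat 1" and \<epsilon>: "\<epsilon> \<in> {1, -1}"
      and eq: "\<And>x. x \<in> sl \<Longrightarrow> transpose (D x) = cscale \<epsilon> (a ** x ** b)"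
      unfolding sl_conjugation_def by blast
    \<comment> \<open>Transposing \<open>a x b\<close> gives \<open>b^t x^t a^t\<close>, so
      \<open>transpose b\<close> takes the place of the conjugating matrix.\<close>
    have t: "transpose b ** transpose a = mat 1" "transpose a ** transpose b = mat 1"
      using ab by (metis matrix_transpose_mul transpose_mat)+
    have "D x = cscale \<epsilon> (transpose b ** transpose x ** transpose a)" if "x \<in> sl" for x
      using arg_cong[OF eq[OF that], of transpose]
      by (simp add: transpose_cscale matrix_transpose_mul matrix_mul_assoc)
    then show ?rhs using \<epsilon> matrix_inv_eqI[OF t] by metis
  qed
next
  assume ?rhs
  then obtain a \<epsilon> where "invertible a" and \<epsilon>: "\<epsilon> \<in> {1, -1}"
    and eq: "(\<forall>x\<in>sl. D x = cscale \<epsilon> (a ** x ** matrix_inv a)) \<or>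
        (\<forall>x\<in>sl. D x = cscale \<epsilon> (a ** transpose x ** matrix_inv a))"
    by blast
  then obtain b where "a ** b = mat 1" "b ** a = mat 1" by (auto simp: invertible_def)
  with matrix_inv_eqI(2) have "a ** matrix_inv a = mat 1" "matrix_inv a ** a = mat 1" by metis+
  then show "sl_local_automorphism D"
    using sl_local_automorphism_if_conjugation[OF assms(2) _ _ \<epsilon> eq] by blast
qed

end
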